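(* Let $X$ be a metrizable Priestley space. Then $X$ is not dual to a bi-Heyting algebra if and only if at least one of the following holds: (a) one of $Z_1,Z_2,Z_3$ is a forbidden configuration for $X$, i.e. there are $i\in\{1,2,3\}$, a topological and order embedding $e\colon Z_i\to X$, and an open neighborhood $U$ of $e(y)$ such that $e^{-1}({\downarrow}U)=\{x,y\}$; (b) there are $i\in\{1,2,3\}$, a topological and order embedding $e\colon Z_i^*\to X$, and an open neighborhood $U$ of $e(y)$ such that $e^{-1}({\uparrow}U)=\{x,y\}$.
   Context: For a poset $X$ and $A\subseteq X$, ${\downarrow}A=\{x\mid x\le a\text{ for some }a\in A\}$ and ${\uparrow}A=\{x\mid a\le x\text{ for some }a\in A\}$; $A$ is an upset if ${\uparrow}A=A$. A Priestley space is a compact topological space $X$ with a partial order such that whenever $x\nleq y$ there is a clopen upset $U$ with $x\in U$, $y\notin U$. By Priestley duality, each Priestley space $X$ is the dual of the bounded distributive lattice of its clopen upsets. A bi-Heyting algebra is a lattice that is both a Heyting algebra and a co-Heyting algebra (the order-dual of a Heyting algebra); $X$ is dual to a bi-Heyting algebra when its lattice of clopen upsets is a bi-Heyting algebra, equivalently, when both the upset and the downset of each open subset of $X$ are open. The Priestley spaces $Z_1,Z_2,Z_3$ all have as underlying topological space the one-point compactification of the countable discrete space $\{y\}\cup\{z_n\mid n\in\omega\}$ (all points distinct), where $x$ is the added point. Their orders have exactly the following strict relations. - $Z_1$: $x<y$; $z_0>z_1>z_2>\cdots$; $x<z_n$ for all $n$. - $Z_2$: $x<y$ and $x<z_n$ for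 all $n$. - $Z_3$: $x<y$ only. $Z_i^*$ is the Priestley space obtained from $Z_i$ by reversing the order. *)

theory Defs
  imports "HOL-Analysis.Analysis" "HOL-Algebra.Lattice"
begin

section \<open>Priestley spaces\<close>

text \<open>A partial order on a space is a relation \<open>r\<close>, with \<open>(x, y) \<in> r\<close> meaning \<open>x \<le> y\<close>. Since
  \<open>partial_order_on\<close> includes that \<open>r\<close> lives on the carrier of the space, the closures of any
  set below are subsets of that carrier.\<close>

definition upclosure :: "('a \<times> 'a) set \<Rightarrow> 'a set \<Rightarrow> 'a set" where
  "upclosure r A = {x. \<exists>a\<in>A. (a, x) \<in> r}"

definition downclosure :: "('a \<times> 'a) set \<Rightarrow> 'a set \<Rightarrow> 'a set" where
  "downclosure r A = {x. \<exists>a\<in>A. (x, a) \<in> r}"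

definition clopen_upsets :: "'a topology \<Rightarrow> ('a \<times> 'a) set \<Rightarrow> 'a set set" where
  "clopen_upsets X r = {U. openin X U \<and> closedin X U \<and> upclosure r U = U}"

definition Priestley_space :: "'a topology \<Rightarrow> ('a \<times> 'a) set \<Rightarrow> bool" where
  "Priestley_space X r \<longleftrightarrow>
     compact_space X \<and> partial_order_on (topspace X) r \<and>
     (\<forall>x\<in>topspace X. \<forall>y\<in>topspace X.
        (x, y) \<notin> r \<longrightarrow> (\<exists>U\<in>clopen_upsets X r. x \<in> U \<and> y \<notin> U))"

section \<open>Bi-Heyting algebras\<close>

definition Heyting_algebra :: "'b gorder \<Rightarrow> bool" where
  "Heyting_algebra L \<longleftrightarrow>
     bounded_lattice L \<and>
     (\<forall>a\<in>carrier L. \<forall>b\<in>carrier L.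
        \<exists>c. greatest L c {d \<in> carrier L. a \<sqinter>\<^bsub>L\<^esub> d \<sqsubseteq>\<^bsub>L\<^esub> b})"

definition bi_Heyting_algebra :: "'b gorder \<Rightarrow> bool" where
  "bi_Heyting_algebra L \<longleftrightarrow> Heyting_algebra L \<and> Heyting_algebra (inv_gorder L)"

definition clopen_upset_lattice :: "'a topology \<Rightarrow> ('a \<times> 'a) set \<Rightarrow> 'a set gorder" where
  "clopen_upset_lattice X r = \<lparr>carrier = clopen_upsets X r, eq = (=), le = (\<subseteq>)\<rparr>"

definition dual_to_bi_Heyting_algebra :: "'a topology \<Rightarrow> ('a \<times> 'a) set \<Rightarrow> bool" where
  "dual_to_bi_Heyting_algebra X r \<longleftrightarrow> bi_Heyting_algebra (clopen_upset_lattice X r)"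

section \<open>The spaces \<open>Z\<^sub>1\<close>, \<open>Z\<^sub>2\<close>, \<open>Z\<^sub>3\<close>\<close>

text \<open>The isolated points are \<open>y\<close> and the \<open>z\<^sub>n\<close>. In \<open>Alexandroff_compactification\<close>, the added
  point (here \<open>x\<close>) is \<open>None\<close>, and an isolated point \<open>p\<close> becomes \<open>Some p\<close>.\<close>

datatype isolated_pt = Iso_y | Iso_z nat

type_synonym Z_pts = "isolated_pt option"

abbreviation x_pt :: Z_pts where "x_pt \<equiv> None"
abbreviation y_pt :: Z_pts where "y_pt \<equiv> Some Iso_y"
abbreviation z_pt :: "nat \<Rightarrow> Z_pts" where "z_pt n \<equiv> Some (Iso_z n)"

definition Z_space :: "Z_pts topology" where
  "Z_space = Alexandroff_compactification (discrete_topology UNIV)"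

definition Z1_order :: "(Z_pts \<times> Z_pts) set" where
  "Z1_order = Id \<union> {(x_pt, y_pt)} \<union> {(z_pt m, z_pt n) | m n. n < m} \<union> {(x_pt, z_pt n) | n. True}"

definition Z2_order :: "(Z_pts \<times> Z_pts) set" where
  "Z2_order = Id \<union> {(x_pt, y_pt)} \<union> {(x_pt, z_pt n) | n. True}"

definition Z3_order :: "(Z_pts \<times> Z_pts) set" where
  "Z3_order = Id \<union> {(x_pt, y_pt)}"

definition top_order_embedding ::
  "'a topology \<Rightarrow> ('a \<times> 'a) set \<Rightarrow> 'b topology \<Rightarrow> ('b \<times> 'b) set \<Rightarrow> ('a \<Rightarrow> 'b) \<Rightarrow> bool" where
  "top_order_embedding W s X r e \<longleftrightarrow>
     embedding_map W X e \<and>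
     (\<forall>p\<in>topspace W. \<forall>q\<in>topspace W. (e p, e q) \<in> r \<longleftrightarrow> (p, q) \<in> s)"

end

theory Submission
  imports Defs "HOL-Library.Ramsey"
begin

text \<open>By Esakia's criterion the clopen upsets form a Heyting algebra iff the downset of every open
  set is open, and complementation turns the co-Heyting condition into the Heyting condition for the
  reversed order. If \<open>e\<close> embeds some \<open>Z\<^sub>i\<close> as in (a), then \<open>{x, y}\<close> would be open in \<open>Z\<^sub>i\<close> if
  \<open>\<down>U\<close> were open, although \<open>z\<^sub>n \<longlonglongrightarrow> x\<close>. Conversely, if \<open>\<down>O\<close> is not open, some sequence outside
  \<open>\<down>O\<close> converges to a point \<open>x \<in> \<down>O\<close>, say \<open>x < y \<in> O\<close>. As the order is closed, increasing pairs
  \<open>z\<^sub>i \<le> z\<^sub>j\<close> with \<open>i < j\<close> and pairs \<open>y \<le> z\<^sub>j\<close> can be avoided by thinning out. Ramsey's theorem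
  makes the remaining sequence either strictly decreasing, which gives \<open>Z\<^sub>1\<close>, or an antichain that lies
  entirely above \<open>x\<close> or is entirely incomparable to it, which gives \<open>Z\<^sub>2\<close> or \<open>Z\<^sub>3\<close>.\<close>

section \<open>Clopen upsets of a Priestley space\<close>

lemma upclosure_converse: "upclosure (r\<inverse>) A = downclosure r A"
  by (simp add: upclosure_def downclosure_def)

lemma downclosure_converse: "downclosure (r\<inverse>) A = upclosure r A"
  by (simp add: upclosure_def downclosure_def)

text \<open>Compactness yields a finite subcover, and closure under \<open>{}\<close> and binary
  unions merges it into a single member. Both separation results below use compactness in this
  form.\<close>

lemma closedin_directed_cover:
  assumes "compact_space X" "closedin X C" "C \<subseteq> \<Union>\<G>"
    and "\<And>G. G \<in> \<G> \<Longrightarrow> openin X G"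
    and "{} \<in> \<G>" and "\<And>G H. G \<in> \<G> \<Longrightarrow> H \<in> \<G> \<Longrightarrow> G \<union> H \<in> \<G>"
  shows "\<exists>G\<in>\<G>. C \<subseteq> G"
proof -
  obtain \<F> where "finite \<F>" "\<F> \<subseteq> \<G>" "C \<subseteq> \<Union>\<F>"
    using closedin_compact_space[OF assms(1,2)] assms(3,4) unfolding compactin_def by metis
  moreover have "\<Union>\<F> \<in> \<G>" if "finite \<F>" "\<F> \<subseteq> \<G>" for \<F>
    using that by (induction \<F>) (use assms(5,6) in auto)
  ultimately show ?thesis by blast
qed

lemma (in bounded_lattice) dual_bounded_lattice: "bounded_lattice (inv_gorder L)"
proof -
  interpret dual: lattice "inv_gorder L" by (rule dual_lattice)
  show ?thesis
    by unfold_locales (simp_all only: least_dual greatest_dual, simp_all add: top_exists bottom_exists)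
qed

locale priestley =
  fixes X :: "'a topology" and r :: "('a \<times> 'a) set"
  assumes Priestley: "Priestley_space X r"
begin

lemma compact: "compact_space X"
  using Priestley by (simp add: Priestley_space_def)

lemma r_carrier: "(x, y) \<in> r \<Longrightarrow> x \<in> topspace X \<and> y \<in> topspace X"
  using Priestley by (auto simp: Priestley_space_def partial_order_on_def preorder_on_def refl_on_def)

lemma r_refl: "x \<in> topspace X \<Longrightarrow> (x, x) \<in> r"
  using Priestley by (auto simp: Priestley_space_def partial_order_on_def preorder_on_def refl_on_def)

lemma r_trans: "(x, y) \<in> r \<Longrightarrow> (y, z) \<in> r \<Longrightarrow> (x, z) \<in> r"
  using Priestley by (auto simp: Priestley_space_def partial_order_on_def preorder_on_def elim: transE)

lemma r_antisym: "(x, y) \<in> r \<Longrightarrow> (y, x) \<in> r \<Longrightarrow> x = y"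
  using Priestley by (auto simp: Priestley_space_def partial_order_on_def elim: antisymD)

lemma separation:
  "x \<in> topspace X \<Longrightarrow> y \<in> topspace X \<Longrightarrow> (x, y) \<notin> r \<Longrightarrow> \<exists>U\<in>clopen_upsets X r. x \<in> U \<and> y \<notin> U"
  using Priestley by (simp add: Priestley_space_def)

lemma clopen_upsets_iff:
  "U \<in> clopen_upsets X r \<longleftrightarrow>
     openin X U \<and> closedin X U \<and> (\<forall>u v. u \<in> U \<longrightarrow> (u, v) \<in> r \<longrightarrow> v \<in> U)"
proof -
  have "upclosure r U = U \<longleftrightarrow> (\<forall>u v. u \<in> U \<longrightarrow> (u, v) \<in> r \<longrightarrow> v \<in> U)" if "openin X U"
    using openin_subset[OF that] r_refl unfolding upclosure_def by blast
  then show ?thesis by (auto simp: clopen_upsets_def)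
qed

lemma clopen_upsets_subset: "U \<in> clopen_upsets X r \<Longrightarrow> U \<subseteq> topspace X"
  by (simp add: clopen_upsets_iff openin_subset)

lemma clopen_upsets_empty: "{} \<in> clopen_upsets X r"
  by (simp add: clopen_upsets_iff)

lemma clopen_upsets_topspace: "topspace X \<in> clopen_upsets X r"
  using r_carrier by (auto simp: clopen_upsets_iff)

lemma clopen_upsets_Int: "U \<in> clopen_upsets X r \<Longrightarrow> V \<in> clopen_upsets X r \<Longrightarrow> U \<inter> V \<in> clopen_upsets X r"
  by (auto simp: clopen_upsets_iff)

lemma clopen_upsets_Un: "U \<in> clopen_upsets X r \<Longrightarrow> V \<in> clopen_upsets X r \<Longrightarrow> U \<union> V \<in> clopen_upsets X r"
  by (auto simp: clopen_upsets_iff)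

lemma subset_downclosure: "A \<subseteq> topspace X \<Longrightarrow> A \<subseteq> downclosure r A"
  using r_refl by (auto simp: downclosure_def)

lemma downclosure_subset: "downclosure r A \<subseteq> topspace X"
  using r_carrier by (auto simp: downclosure_def)

text \<open>No point of \<open>C\<close> lies above \<open>p\<close>, so each is missed by some
  clopen upset through \<open>p\<close>. The complements of these upsets form a directed open cover
  of \<open>C\<close>, because clopen upsets are closed under intersection.\<close>

lemma clopen_upset_avoiding_closed:
  assumes "closedin X C" "p \<in> topspace X" "p \<notin> downclosure r C"
  shows "\<exists>W\<in>clopen_upsets X r. p \<in> W \<and> W \<inter> C = {}"
proof -
  let ?G = "{topspace X - W |W. W \<in> clopen_upsets X r \<and> p \<in> W}"
  have "\<exists>G\<in>?G. C \<subseteq> G"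
  proof (rule closedin_directed_cover[OF compact assms(1)])
    show "C \<subseteq> \<Union>?G"
    proof
      fix c assume "c \<in> C"
      then have "c \<in> topspace X" "(p, c) \<notin> r"
        using assms closedin_subset by (auto simp: downclosure_def)
      then show "c \<in> \<Union>?G" using separation[OF assms(2)] by blast
    qed
    show "{} \<in> ?G" using clopen_upsets_topspace assms(2) by blast
    show "openin X G" if "G \<in> ?G" for G using that by (auto simp: clopen_upsets_iff)
    show "G \<union> H \<in> ?G" if GH: "G \<in> ?G" "H \<in> ?G" for G H
    proof -
      obtain V W where "G = topspace X - V" "H = topspace X - W" "V \<in> clopen_upsets X r"
        "W \<in> clopen_upsets X r" "p \<in> V \<inter> W" using GH by blast
      then show ?thesis using clopen_upsets_Int[of V W] by blast
    qed
  qed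
  then show ?thesis by blast
qed

text \<open>Differences of clopen upsets form a base. By antisymmetry a point \<open>c\<close>
  outside \<open>B\<close> fails \<open>p \<le> c\<close> or \<open>c \<le> p\<close>; the first
  failure supplies a \<open>U\<close> missing \<open>c\<close>, the second a \<open>V\<close>
  containing \<open>c\<close>. Compactness turns these choices into a single pair.\<close>

lemma clopen_upset_difference_basis:
  assumes "openin X B" "p \<in> B"
  shows "\<exists>U\<in>clopen_upsets X r. \<exists>V\<in>clopen_upsets X r. p \<in> U - V \<and> U - V \<subseteq> B"
proof -
  have p: "p \<in> topspace X" using assms openin_subset by blast
  let ?G = "{topspace X - (U - V) |U V. U \<in> clopen_upsets X r \<and> V \<in> clopen_upsets X r \<and> p \<in> U - V}"
  have "\<exists>G\<in>?G. topspace X - B \<subseteq> G"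
  proof (rule closedin_directed_cover[OF compact])
    show "closedin X (topspace X - B)" using assms by blast
    show "topspace X - B \<subseteq> \<Union>?G"
    proof
      fix c assume c: "c \<in> topspace X - B"
      then have "(p, c) \<notin> r \<or> (c, p) \<notin> r" using assms(2) r_antisym by blast
      then show "c \<in> \<Union>?G"
      proof
        assume "(p, c) \<notin> r"
        then obtain U where "U \<in> clopen_upsets X r" "p \<in> U - {}" "c \<notin> U" using separation p c by blast
        then show ?thesis using clopen_upsets_empty c by blast
      next
        assume "(c, p) \<notin> r"
        then obtain V where "V \<in> clopen_upsets X r" "p \<in> topspace X - V" "c \<in> V" using separation p c by blast
        then show ?thesis using clopen_upsets_topspace c by blast
      qed
    qed
    have "p \<in> topspace X - {}" "{} = topspace X - (topspace X - {})" using p by auto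
    then show "{} \<in> ?G" using clopen_upsets_topspace clopen_upsets_empty by blast
    show "openin X G" if "G \<in> ?G" for G
      using that by (auto simp: clopen_upsets_iff intro!: openin_diff closedin_diff)
    show "G \<union> H \<in> ?G" if GH: "G \<in> ?G" "H \<in> ?G" for G H
    proof -
      obtain U V U' V' where *: "G = topspace X - (U - V)" "H = topspace X - (U' - V')"
        "U \<in> clopen_upsets X r" "V \<in> clopen_upsets X r" "U' \<in> clopen_upsets X r"
        "V' \<in> clopen_upsets X r" "p \<in> U - V" "p \<in> U' - V'" using GH by blast
      then have "G \<union> H = topspace X - ((U \<inter> U') - (V \<union> V'))" "p \<in> (U \<inter> U') - (V \<union> V')" by blast+
      then show ?thesis
        using clopen_upsets_Int[OF *(3,5)] clopen_upsets_Un[OF *(4,6)] by blast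
    qed
  qed
  then obtain U V where *: "U \<in> clopen_upsets X r" "V \<in> clopen_upsets X r" "p \<in> U - V"
    "topspace X - B \<subseteq> topspace X - (U - V)" by blast
  then have "U - V \<subseteq> B" using clopen_upsets_subset[OF *(1)] by blast
  with * show ?thesis by blast
qed

text \<open>An upset that misses \<open>C\<close> also misses \<down>C, so the clopen upset
  separating a point from \<open>C\<close> is a neighbourhood of it outside \<down>C.\<close>

lemma closedin_downclosure:
  assumes "closedin X C"
  shows "closedin X (downclosure r C)"
proof -
  have "openin X (topspace X - downclosure r C)"
  proof (subst openin_subopen, intro ballI)
    fix p assume "p \<in> topspace X - downclosure r C"
    then obtain W where W: "W \<in> clopen_upsets X r" "p \<in> W" "W \<inter> C = {}"
      using clopen_upset_avoiding_closed[OF assms] by blast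
    then have "openin X W" "W \<subseteq> topspace X - downclosure r C"
      using clopen_upsets_subset unfolding clopen_upsets_iff downclosure_def by blast+
    with W show "\<exists>T. openin X T \<and> p \<in> T \<and> T \<subseteq> topspace X - downclosure r C" by blast
  qed
  then show ?thesis by (simp add: closedin_def downclosure_subset)
qed

section \<open>The lattice of clopen upsets\<close>

lemma bounded_lattice_clopen_upsets: "bounded_lattice (clopen_upset_lattice X r)"
proof -
  let ?L = "clopen_upset_lattice X r"
  have "greatest ?L (U \<inter> V) (Lower ?L {U, V})" "least ?L (U \<union> V) (Upper ?L {U, V})"
    if "U \<in> carrier ?L" "V \<in> carrier ?L" for U V
    using that clopen_upsets_Int[of U V] clopen_upsets_Un[of U V]
    by (auto simp: clopen_upset_lattice_def greatest_def least_def Lower_def Upper_def)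
  moreover have "greatest ?L (topspace X) (carrier ?L)" "least ?L {} (carrier ?L)"
    using clopen_upsets_topspace clopen_upsets_empty clopen_upsets_subset
    by (auto simp: clopen_upset_lattice_def greatest_def least_def)
  ultimately show ?thesis
    by unfold_locales (simp add: clopen_upset_lattice_def; blast)+
qed

text \<open>The meet of a lattice is a chosen greatest lower bound, so it is identified with the
  intersection through uniqueness of such bounds.\<close>

lemma meet_clopen_upsets:
  assumes "U \<in> clopen_upsets X r" "V \<in> clopen_upsets X r"
  shows "U \<sqinter>\<^bsub>clopen_upset_lattice X r\<^esub> V = U \<inter> V"
proof -
  let ?L = "clopen_upset_lattice X r"
  interpret bounded_lattice ?L by (rule bounded_lattice_clopen_upsets)
  have glb: "greatest ?L (U \<inter> V) (Lower ?L {U, V})"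
    using assms clopen_upsets_Int
    by (auto simp: clopen_upset_lattice_def greatest_def Lower_def)
  show ?thesis
    by (rule meetI[where P = "\<lambda>W. W = U \<inter> V"], erule greatest_unique[OF _ glb])
      (simp_all add: assms clopen_upset_lattice_def)
qed

lemma join_clopen_upsets:
  assumes "U \<in> clopen_upsets X r" "V \<in> clopen_upsets X r"
  shows "U \<squnion>\<^bsub>clopen_upset_lattice X r\<^esub> V = U \<union> V"
proof -
  let ?L = "clopen_upset_lattice X r"
  interpret bounded_lattice ?L by (rule bounded_lattice_clopen_upsets)
  have lub: "least ?L (U \<union> V) (Upper ?L {U, V})"
    using assms clopen_upsets_Un
    by (auto simp: clopen_upset_lattice_def least_def Upper_def)
  show ?thesis
    by (rule joinI[where P = "\<lambda>W. W = U \<union> V"], erule least_unique[OF _ lub])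
      (simp_all add: assms clopen_upset_lattice_def)
qed

section \<open>Heyting implications and Esakia's criterion\<close>

text \<open>The set of all \<open>d\<close> with \<open>a \<inter> d \<subseteq> b\<close> is closed
  under passing to smaller clopen upsets. Hence \<open>c\<close> is its greatest element exactly
  when membership of \<open>d\<close> means \<open>d \<subseteq> c\<close>, which is the usual
  adjunction.\<close>

lemma Heyting_algebra_clopen_upsets_iff:
  "Heyting_algebra (clopen_upset_lattice X r) \<longleftrightarrow>
    (\<forall>a\<in>clopen_upsets X r. \<forall>b\<in>clopen_upsets X r. \<exists>c\<in>clopen_upsets X r.
      \<forall>d\<in>clopen_upsets X r. a \<inter> d \<subseteq> b \<longleftrightarrow> d \<subseteq> c)" (is "_ \<longleftrightarrow> ?rhs")
proof -
  let ?L = "clopen_upset_lattice X r"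
  have carrier: "carrier ?L = clopen_upsets X r" by (simp add: clopen_upset_lattice_def)
  have "(\<exists>c. greatest ?L c {d \<in> carrier ?L. a \<sqinter>\<^bsub>?L\<^esub> d \<sqsubseteq>\<^bsub>?L\<^esub> b}) \<longleftrightarrow>
    (\<exists>c\<in>clopen_upsets X r. \<forall>d\<in>clopen_upsets X r. a \<inter> d \<subseteq> b \<longleftrightarrow> d \<subseteq> c)"
    if a: "a \<in> clopen_upsets X r" for a b
  proof -
    have eq: "{d \<in> carrier ?L. a \<sqinter>\<^bsub>?L\<^esub> d \<sqsubseteq>\<^bsub>?L\<^esub> b} = {d \<in> clopen_upsets X r. a \<inter> d \<subseteq> b}"
      using meet_clopen_upsets[OF a] by (auto simp: clopen_upset_lattice_def)
    have "greatest ?L c {d \<in> clopen_upsets X r. a \<inter> d \<subseteq> b} \<longleftrightarrow>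
      c \<in> clopen_upsets X r \<and> (\<forall>d\<in>clopen_upsets X r. a \<inter> d \<subseteq> b \<longleftrightarrow> d \<subseteq> c)" for c
      unfolding greatest_def by (simp add: clopen_upset_lattice_def) blast
    then show ?thesis unfolding eq Bex_def by (simp only:)
  qed
  then have "(\<forall>a\<in>carrier ?L. \<forall>b\<in>carrier ?L.
      \<exists>c. greatest ?L c {d \<in> carrier ?L. a \<sqinter>\<^bsub>?L\<^esub> d \<sqsubseteq>\<^bsub>?L\<^esub> b}) \<longleftrightarrow> ?rhs"
    unfolding carrier by (intro ball_cong refl)
  then show ?thesis
    by (simp only: Heyting_algebra_def bounded_lattice_clopen_upsets simp_thms)
qed

lemma Heyting_algebra_dual_clopen_upsets_iff:
  "Heyting_algebra (inv_gorder (clopen_upset_lattice X r)) \<longleftrightarrow>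
    (\<forall>a\<in>clopen_upsets X r. \<forall>b\<in>clopen_upsets X r. \<exists>c\<in>clopen_upsets X r.
      \<forall>d\<in>clopen_upsets X r. b \<subseteq> a \<union> d \<longleftrightarrow> c \<subseteq> d)" (is "_ \<longleftrightarrow> ?rhs")
proof -
  let ?L = "clopen_upset_lattice X r"
  have carrier: "carrier ?L = clopen_upsets X r" by (simp add: clopen_upset_lattice_def)
  have "(\<exists>c. least ?L c {d \<in> carrier ?L. b \<sqsubseteq>\<^bsub>?L\<^esub> a \<squnion>\<^bsub>?L\<^esub> d}) \<longleftrightarrow>
    (\<exists>c\<in>clopen_upsets X r. \<forall>d\<in>clopen_upsets X r. b \<subseteq> a \<union> d \<longleftrightarrow> c \<subseteq> d)"
    if a: "a \<in> clopen_upsets X r" for a b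
  proof -
    have eq: "{d \<in> carrier ?L. b \<sqsubseteq>\<^bsub>?L\<^esub> a \<squnion>\<^bsub>?L\<^esub> d} = {d \<in> clopen_upsets X r. b \<subseteq> a \<union> d}"
      using join_clopen_upsets[OF a] by (auto simp: clopen_upset_lattice_def)
    have "least ?L c {d \<in> clopen_upsets X r. b \<subseteq> a \<union> d} \<longleftrightarrow>
      c \<in> clopen_upsets X r \<and> (\<forall>d\<in>clopen_upsets X r. b \<subseteq> a \<union> d \<longleftrightarrow> c \<subseteq> d)" for c
      unfolding least_def by (simp add: clopen_upset_lattice_def) blast
    then show ?thesis unfolding eq Bex_def by (simp only:)
  qed
  then have "(\<forall>a\<in>carrier ?L. \<forall>b\<in>carrier ?L.
      \<exists>c. least ?L c {d \<in> carrier ?L. b \<sqsubseteq>\<^bsub>?L\<^esub> a \<squnion>\<^bsub>?L\<^esub> d}) \<longleftrightarrow> ?rhs"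
    unfolding carrier by (intro ball_cong refl)
  moreover have "Heyting_algebra (inv_gorder ?L) \<longleftrightarrow> (\<forall>a\<in>carrier ?L. \<forall>b\<in>carrier ?L.
      \<exists>c. least ?L c {d \<in> carrier ?L. b \<sqsubseteq>\<^bsub>?L\<^esub> a \<squnion>\<^bsub>?L\<^esub> d})"
    unfolding Heyting_algebra_def greatest_dual meet_dual
    by (simp only: bounded_lattice.dual_bounded_lattice[OF bounded_lattice_clopen_upsets]
        partial_object.simps gorder.simps simp_thms)
  ultimately show ?thesis by (simp only:)
qed

text \<open>The relative pseudocomplement \<open>U \<Rightarrow> V\<close> is the complement of \<open>\<down>(U - V)\<close>.\<close>

lemma Heyting_algebra_iff_open_downclosure:
  "Heyting_algebra (clopen_upset_lattice X r) \<longleftrightarrow> (\<forall>B. openin X B \<longrightarrow> openin X (downclosure r B))"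
proof
  assume H: "Heyting_algebra (clopen_upset_lattice X r)"
  have diff: "openin X (downclosure r (U - V))"
    if U: "U \<in> clopen_upsets X r" and V: "V \<in> clopen_upsets X r" for U V
  proof -
    obtain W where W: "W \<in> clopen_upsets X r"
      and "\<forall>D\<in>clopen_upsets X r. U \<inter> D \<subseteq> V \<longleftrightarrow> D \<subseteq> W"
      by (rule H[unfolded Heyting_algebra_clopen_upsets_iff, THEN bspec, THEN bspec, OF U V, THEN bexE])
    note max = bspec[OF this(2)]
    have "downclosure r (U - V) = topspace X - W"
    proof (intro equalityI subsetI)
      fix p assume p: "p \<in> downclosure r (U - V)"
      then obtain u where "u \<in> U - V" "(p, u) \<in> r" by (auto simp: downclosure_def)
      moreover have "U \<inter> W \<subseteq> V" using max[OF W] by simp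
      ultimately show "p \<in> topspace X - W" using W r_carrier unfolding clopen_upsets_iff by blast
    next
      fix p assume p: "p \<in> topspace X - W"
      show "p \<in> downclosure r (U - V)"
      \<comment> \<open>A clopen upset \<open>D\<close> through \<open>p\<close> missing
        \<open>U - V\<close> satisfies \<open>U \<inter> D \<subseteq> V\<close>, so maximality of
        \<open>W\<close> would put \<open>p\<close> into \<open>W\<close>.\<close>
      proof (rule ccontr)
        assume "p \<notin> downclosure r (U - V)"
        moreover have "closedin X (U - V)"
          using U V by (simp add: clopen_upsets_iff closedin_diff)
        ultimately obtain D where "D \<in> clopen_upsets X r" "p \<in> D" "D \<inter> (U - V) = {}"
          using clopen_upset_avoiding_closed p by blast
        then show False using max[of D] p by blast
      qed
    qed
    then show ?thesis using W by (simp add: clopen_upsets_iff openin_diff)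
  qed
  show "\<forall>B. openin X B \<longrightarrow> openin X (downclosure r B)"
  proof (intro allI impI)
    fix B assume B: "openin X B"
    show "openin X (downclosure r B)"
    proof (rule iffD2[OF openin_subopen], intro ballI)
      fix p assume "p \<in> downclosure r B"
      then obtain b where b: "b \<in> B" "(p, b) \<in> r" by (auto simp: downclosure_def)
      \<comment> \<open>Downsets commute with unions, so openness needs checking only on basic open
        sets \<open>U - V\<close>.\<close>
      obtain U V where "U \<in> clopen_upsets X r" "V \<in> clopen_upsets X r" "b \<in> U - V" "U - V \<subseteq> B"
        using clopen_upset_difference_basis[OF B b(1)] by blast
      moreover from this have "p \<in> downclosure r (U - V)" "downclosure r (U - V) \<subseteq> downclosure r B"
        using b(2) unfolding downclosure_def by blast+
      ultimately show "\<exists>T. openin X T \<and> p \<in> T \<and> T \<subseteq> downclosure r B" using diff by blast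
    qed
  qed
next
  assume H: "\<forall>B. openin X B \<longrightarrow> openin X (downclosure r B)"
  show "Heyting_algebra (clopen_upset_lattice X r)"
    unfolding Heyting_algebra_clopen_upsets_iff
  proof (intro ballI)
    fix U V assume U: "U \<in> clopen_upsets X r" and V: "V \<in> clopen_upsets X r"
    let ?W = "topspace X - downclosure r (U - V)"
    have "openin X (U - V)" "closedin X (U - V)"
      using U V by (simp_all add: clopen_upsets_iff openin_diff closedin_diff)
    then have clopen: "openin X (downclosure r (U - V))" "closedin X (downclosure r (U - V))"
      using H closedin_downclosure by blast+
    have up: "v \<in> ?W" if "u \<in> ?W" "(u, v) \<in> r" for u v
      using that r_carrier r_trans unfolding downclosure_def by blast
    have W: "?W \<in> clopen_upsets X r"
      unfolding clopen_upsets_iff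
      by (intro conjI openin_diff closedin_diff openin_topspace closedin_topspace clopen allI impI)
        (rule up)
    have "U \<inter> D \<subseteq> V \<longleftrightarrow> D \<subseteq> ?W" if D: "D \<in> clopen_upsets X r" for D
    proof
      assume "U \<inter> D \<subseteq> V"
      then show "D \<subseteq> ?W"
        using D clopen_upsets_subset[OF D] unfolding clopen_upsets_iff downclosure_def by blast
    next
      assume "D \<subseteq> ?W"
      then show "U \<inter> D \<subseteq> V"
        using subset_downclosure[of "U - V"] clopen_upsets_subset[OF U] by blast
    qed
    with W show "\<exists>c\<in>clopen_upsets X r. \<forall>d\<in>clopen_upsets X r. U \<inter> d \<subseteq> V \<longleftrightarrow> d \<subseteq> c"
      by (intro bexI[of _ ?W] ballI)
  qed
qed

section \<open>Reversal of the order\<close>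

lemma clopen_upsets_complement:
  assumes "U \<in> clopen_upsets X r"
  shows "topspace X - U \<in> clopen_upsets X (r\<inverse>)"
proof -
  have U: "openin X U" "closedin X U" "\<And>u v. u \<in> U \<Longrightarrow> (u, v) \<in> r \<Longrightarrow> v \<in> U"
    using assms by (auto simp: clopen_upsets_iff)
  have "downclosure r (topspace X - U) \<subseteq> topspace X - U"
    using U(3) r_carrier unfolding downclosure_def by blast
  then have "upclosure (r\<inverse>) (topspace X - U) = topspace X - U"
    using subset_downclosure[of "topspace X - U"] by (auto simp: upclosure_converse)
  then show ?thesis
    using U(1,2) by (simp add: clopen_upsets_def openin_diff closedin_diff)
qed

text \<open>Separating upsets for the reversed order are complements of those for \<open>r\<close>.
  Every result about downsets thereby transfers to upsets.\<close>

lemma priestley_converse: "priestley X (r\<inverse>)"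
proof
  have "\<exists>U\<in>clopen_upsets X (r\<inverse>). x \<in> U \<and> y \<notin> U"
    if xy: "x \<in> topspace X" "y \<in> topspace X" "(x, y) \<notin> r\<inverse>" for x y
  proof -
    obtain U where "U \<in> clopen_upsets X r" "y \<in> U" "x \<notin> U" using separation xy by blast
    then show ?thesis using clopen_upsets_complement[of U] xy by blast
  qed
  moreover have "partial_order_on (topspace X) (r\<inverse>)"
    using Priestley by (simp add: Priestley_space_def)
  ultimately show "Priestley_space X (r\<inverse>)"
    using compact by (simp add: Priestley_space_def)
qed

text \<open>Complementation \<open>k\<close> is an inclusion-reversing bijection between the clopen
  upsets for the two orders. Moving all quantifiers along \<open>k\<close> turns the co-Heyting
  adjunction into the Heyting one.\<close>

lemma Heyting_algebra_dual_iff_converse: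
  "Heyting_algebra (inv_gorder (clopen_upset_lattice X r)) \<longleftrightarrow>
   Heyting_algebra (clopen_upset_lattice X (r\<inverse>))"
proof -
  interpret dual: priestley X "r\<inverse>" by (rule priestley_converse)
  define k where "k U = topspace X - U" for U
  have ball: "(\<forall>U\<in>clopen_upsets X r. P U) \<longleftrightarrow> (\<forall>U\<in>clopen_upsets X (r\<inverse>). P (k U))"
    and bex: "(\<exists>U\<in>clopen_upsets X r. P U) \<longleftrightarrow> (\<exists>U\<in>clopen_upsets X (r\<inverse>). P (k U))" for P
  proof -
    have "k U \<in> clopen_upsets X (r\<inverse>)" "k (k U) = U" if "U \<in> clopen_upsets X r" for U
      using clopen_upsets_complement[OF that] clopen_upsets_subset[OF that]
      by (auto simp: k_def)
    moreover have "k U \<in> clopen_upsets X r" if "U \<in> clopen_upsets X (r\<inverse>)" for U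
      using dual.clopen_upsets_complement[OF that] by (simp add: k_def)
    ultimately show "(\<forall>U\<in>clopen_upsets X r. P U) \<longleftrightarrow> (\<forall>U\<in>clopen_upsets X (r\<inverse>). P (k U))"
      "(\<exists>U\<in>clopen_upsets X r. P U) \<longleftrightarrow> (\<exists>U\<in>clopen_upsets X (r\<inverse>). P (k U))"
      by metis+
  qed
  have "k b \<subseteq> k a \<union> k d \<longleftrightarrow> a \<inter> d \<subseteq> b" "k c \<subseteq> k d \<longleftrightarrow> d \<subseteq> c"
    if "a \<in> clopen_upsets X (r\<inverse>)" "d \<in> clopen_upsets X (r\<inverse>)" for a b c d
    using that[THEN dual.clopen_upsets_subset] by (auto simp: k_def)
  then show ?thesis
    unfolding Heyting_algebra_dual_clopen_upsets_iff dual.Heyting_algebra_clopen_upsets_iff ball bex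
    by (simp cong: ball_cong bex_cong)
qed

lemma dual_to_bi_Heyting_algebra_iff:
  "dual_to_bi_Heyting_algebra X r \<longleftrightarrow>
    (\<forall>B. openin X B \<longrightarrow> openin X (downclosure r B)) \<and> (\<forall>B. openin X B \<longrightarrow> openin X (upclosure r B))"
  by (simp only: dual_to_bi_Heyting_algebra_def bi_Heyting_algebra_def Heyting_algebra_dual_iff_converse
      Heyting_algebra_iff_open_downclosure
      priestley.Heyting_algebra_iff_open_downclosure[OF priestley_converse] downclosure_converse)

section \<open>Limits and the order\<close>

text \<open>A clopen upset containing \<open>w\<close> but not \<open>x\<close> contains everything
  above \<open>w\<close>, while its complement is a neighbourhood of the limit
  \<open>x\<close>.\<close>

lemma eventually_not_above:
  assumes "limitin X z x F" "w \<in> topspace X" "(w, x) \<notin> r"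
  shows "\<forall>\<^sub>F n in F. (w, z n) \<notin> r"
proof -
  have "x \<in> topspace X" using assms(1) by (simp add: limitin_def)
  then obtain U where U: "U \<in> clopen_upsets X r" "w \<in> U" "x \<notin> U"
    using separation assms by blast
  have "\<forall>\<^sub>F n in F. z n \<in> topspace X - U"
    by (rule limitinD[OF assms(1)])
      (use U \<open>x \<in> topspace X\<close> in \<open>simp_all add: clopen_upsets_iff openin_diff\<close>)
  then show ?thesis
    by (rule eventually_mono) (use U in \<open>auto simp: clopen_upsets_iff\<close>)
qed

lemma limit_le:
  assumes "limitin X z x F" "w \<in> topspace X" "\<forall>\<^sub>F n in F. (z n, w) \<in> r" "F \<noteq> bot"
  shows "(x, w) \<in> r"
proof (rule ccontr)
  assume "(x, w) \<notin> r"
  then have "\<forall>\<^sub>F n in F. (z n, w) \<notin> r"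
    using priestley.eventually_not_above[OF priestley_converse assms(1,2)] by simp
  with assms(3) have "\<forall>\<^sub>F n in F. False" by eventually_elim simp
  with assms(4) show False by simp
qed

end

section \<open>The spaces \<open>Z\<^sub>1\<close>, \<open>Z\<^sub>2\<close>, \<open>Z\<^sub>3\<close>\<close>

lemma topspace_Z_space: "topspace Z_space = UNIV"
  by (auto simp: Z_space_def UNIV_option_conv)

text \<open>A neighbourhood of the added point has finite complement. The single point
  \<open>y\<close> does not affect finiteness, so only the indices of missed \<open>z\<close> points
  are counted.\<close>

lemma openin_Z_space_iff: "openin Z_space V \<longleftrightarrow> (x_pt \<in> V \<longrightarrow> finite {n. z_pt n \<notin> V})"
proof -
  have fin: "finite (- (Some -` V)) \<longleftrightarrow> finite {n. z_pt n \<notin> V}"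
  proof
    assume "finite (- (Some -` V))"
    then have "finite (Iso_z -` (- (Some -` V)))" by (rule finite_vimageI) (auto simp: inj_def)
    then show "finite {n. z_pt n \<notin> V}" by (rule rev_finite_subset) auto
  next
    assume "finite {n. z_pt n \<notin> V}"
    moreover have "- (Some -` V) \<subseteq> insert Iso_y (Iso_z ` {n. z_pt n \<notin> V})"
    proof
      fix p assume "p \<in> - (Some -` V)"
      then show "p \<in> insert Iso_y (Iso_z ` {n. z_pt n \<notin> V})" by (cases p) auto
    qed
    ultimately show "finite (- (Some -` V))" by (meson finite_imageI finite_insert finite_subset)
  qed
  have "(\<exists>U. V = Some ` U) \<longleftrightarrow> x_pt \<notin> V"
  proof
    assume "x_pt \<notin> V"
    then have "p \<in> V \<longleftrightarrow> p \<in> Some ` (Some -` V)" for p by (cases p) auto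
    then show "\<exists>U. V = Some ` U" by blast
  qed auto
  moreover have "(\<exists>C. finite C \<and> V = insert x_pt (Some ` (UNIV - C))) \<longleftrightarrow> x_pt \<in> V \<and> finite (- (Some -` V))"
  proof
    assume "\<exists>C. finite C \<and> V = insert x_pt (Some ` (UNIV - C))"
    then obtain C where "finite C" "V = insert x_pt (Some ` (UNIV - C))" by blast
    moreover from this have "- (Some -` V) = C" by auto
    ultimately show "x_pt \<in> V \<and> finite (- (Some -` V))" by auto
  next
    assume *: "x_pt \<in> V \<and> finite (- (Some -` V))"
    have "p \<in> V \<longleftrightarrow> p \<in> insert x_pt (Some ` (UNIV - (- (Some -` V))))" for p
      using * by (cases p) auto
    then have "V = insert x_pt (Some ` (UNIV - (- (Some -` V))))" by blast
    with * show "\<exists>C. finite C \<and> V = insert x_pt (Some ` (UNIV - C))" by blast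
  qed
  ultimately show ?thesis
    by (auto simp: Z_space_def openin_Alexandroff_compactification compactin_discrete_topology fin)
qed

text \<open>All points but \<open>x_pt\<close> are isolated, so convergence at \<open>x_pt\<close>
  is enough for continuity. A continuous injection from a compact space into a Hausdorff space is
  closed, hence an embedding.\<close>

lemma embedding_map_Z_space:
  assumes "Hausdorff_space X" "range e \<subseteq> topspace X" "inj e"
    and lim: "limitin X (\<lambda>n. e (z_pt n)) (e x_pt) sequentially"
  shows "embedding_map Z_space X e"
proof -
  have "continuous_map Z_space X e"
    unfolding continuous_map_def openin_Z_space_iff
  proof (intro conjI allI impI)
    show "e \<in> topspace Z_space \<rightarrow> topspace X" using assms(2) by auto
    fix V assume V: "openin X V" "x_pt \<in> {p \<in> topspace Z_space. e p \<in> V}"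
    then have "\<forall>\<^sub>F n in sequentially. e (z_pt n) \<in> V" using lim by (auto simp: limitin_def)
    then show "finite {n. z_pt n \<notin> {p \<in> topspace Z_space. e p \<in> V}}"
      by (simp add: cofinite_eq_sequentially[symmetric] eventually_cofinite topspace_Z_space)
  qed
  moreover have "compact_space Z_space" by (simp add: Z_space_def)
  ultimately show ?thesis
    using assms by (intro injective_closed_imp_embedding_map continuous_imp_closed_map)
      (auto intro: inj_on_subset)
qed

lemma top_order_embedding_converse:
  "top_order_embedding W (s\<inverse>) X (r\<inverse>) e \<longleftrightarrow> top_order_embedding W s X r e"
  by (auto simp: top_order_embedding_def)

section \<open>Ramsey's theorem for subsequences\<close>

lemma monochromatic_subsequence:
  fixes P :: "nat \<Rightarrow> nat \<Rightarrow> bool"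
  obtains f :: "nat \<Rightarrow> nat" where "strict_mono f"
    "(\<forall>i j. i < j \<longrightarrow> P (f i) (f j)) \<or> (\<forall>i j. i < j \<longrightarrow> \<not> P (f i) (f j))"
proof -
  \<comment> \<open>Ramsey's theorem colours unordered pairs, whereas \<open>P\<close> need not be
    symmetric; \<open>Min\<close> and \<open>Max\<close> recover the order of the two
    indices.\<close>
  define c :: "nat set \<Rightarrow> nat" where "c A = of_bool (P (Min A) (Max A))" for A
  have "\<forall>i\<in>UNIV. \<forall>j\<in>UNIV. i \<noteq> j \<longrightarrow> c {i, j} < 2" by (simp add: c_def)
  then obtain Y t where Y: "infinite Y" "\<forall>i\<in>Y. \<forall>j\<in>Y. i \<noteq> j \<longrightarrow> c {i, j} = t"
    using Ramsey2[OF infinite_UNIV_nat, of c 2] by blast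
  let ?f = "enumerate Y"
  have f: "strict_mono ?f" using Y(1) by (simp add: strict_mono_enumerate)
  have "of_bool (P (?f i) (?f j)) = t" if "i < j" for i j
  proof -
    have "?f i < ?f j" using f that by (simp add: strict_mono_less)
    moreover have "c {?f i, ?f j} = t"
      using Y calculation enumerate_in_set[OF Y(1)] by (metis less_irrefl)
    ultimately show ?thesis by (simp add: c_def min_def max_def)
  qed
  then have "(\<forall>i j. i < j \<longrightarrow> P (?f i) (?f j)) \<or> (\<forall>i j. i < j \<longrightarrow> \<not> P (?f i) (?f j))"
    by (metis of_bool_eq_iff)
  with f show thesis by (rule that)
qed

section \<open>Forbidden configurations\<close>

context priestley
begin

text \<open>Otherwise the preimage \<open>{x_pt, y_pt}\<close> would be an open neighbourhood of
  \<open>x_pt\<close> missing every \<open>z_pt n\<close>.\<close>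

lemma forbidden_configuration_imp_not_open:
  assumes e: "top_order_embedding Z_space s X r e"
    and "{p \<in> topspace Z_space. e p \<in> downclosure r U} = {x_pt, y_pt}"
  shows "\<not> openin X (downclosure r U)"
proof
  assume "openin X (downclosure r U)"
  moreover have "continuous_map Z_space X e"
    using e by (simp add: top_order_embedding_def embedding_map_def homeomorphic_imp_continuous_map
        continuous_map_in_subtopology homeomorphic_eq_everything_map)
  ultimately have "openin Z_space {x_pt, y_pt}"
    using assms(2) openin_continuous_map_preimage by fastforce
  then show False by (simp add: openin_Z_space_iff)
qed

text \<open>The given \<open>U\<close> serves as the neighbourhood in the configuration; only the
  sequence is changed. Subsequences keep the limit and stay outside \<down>U, so the thinnings can
  be made one after another.\<close>

lemma forbidden_configuration_of_sequence:
  fixes z :: "nat \<Rightarrow> 'a"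
  assumes "Hausdorff_space X" and U: "openin X U" "y \<in> U" "x \<notin> U" and xy: "(x, y) \<in> r"
    and lim: "limitin X z x sequentially"
    and z: "\<And>n. z n \<in> topspace X - downclosure r U"
  shows "\<exists>s\<in>{Z1_order, Z2_order, Z3_order}. \<exists>e. top_order_embedding Z_space s X r e \<and>
    e y_pt = y \<and> {p \<in> topspace Z_space. e p \<in> downclosure r U} = {x_pt, y_pt}"
proof -
  have carrier: "x \<in> topspace X" "y \<in> topspace X" using r_carrier xy by blast+
  have x_down: "x \<in> downclosure r U" using xy U(2) by (auto simp: downclosure_def)
  have y_down: "y \<in> downclosure r U" using U(2) carrier r_refl by (auto simp: downclosure_def)
  have z_not_le: "(z n, p) \<notin> r" if "p \<in> downclosure r U" for n p
    using z[of n] that r_trans unfolding downclosure_def by blast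
  have y_not_le_x: "(y, x) \<notin> r" using r_antisym[OF xy] U by blast
  \<comment> \<open>Since \<open>x\<close> lies in \<down>U and \<open>z i\<close> does not,
    \<open>z i\<close> is not below the limit.\<close>
  have no_increase: "\<forall>\<^sub>F j in sequentially. (z i, z j) \<notin> r" for i
    using eventually_not_above[OF lim _ z_not_le[OF x_down]] z by simp

  obtain f1 :: "nat \<Rightarrow> nat" where f1: "strict_mono f1"
    "(\<forall>i j. i < j \<longrightarrow> (z (f1 i), z (f1 j)) \<notin> r) \<or> (\<forall>i j. i < j \<longrightarrow> \<not> (z (f1 i), z (f1 j)) \<notin> r)"
    by (rule monochromatic_subsequence[of "\<lambda>i j. (z i, z j) \<notin> r"])
  have lim1: "limitin X (z \<circ> f1) x sequentially" using limitin_subsequence[OF f1(1) lim] .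
  have f1_incr: "(z (f1 i), z (f1 j)) \<notin> r" if "i < j" for i j
  proof -
    \<comment> \<open>In the other alternative \<open>z (f1 0)\<close> would lie below every later
      term, which contradicts \<open>no_increase\<close> for this single term.\<close>
    have "\<forall>\<^sub>F j in sequentially. (z (f1 0), z (f1 j)) \<notin> r"
      using eventually_subseq[OF f1(1) no_increase] .
    then obtain N where "\<forall>j\<ge>N. (z (f1 0), z (f1 j)) \<notin> r" by (auto simp: eventually_sequentially)
    then have "(z (f1 0), z (f1 (Suc N))) \<notin> r" by simp
    then show ?thesis using f1(2) that by (metis zero_less_Suc)
  qed
  obtain f2 :: "nat \<Rightarrow> nat" where f2: "strict_mono f2"
    "(\<forall>i j. i < j \<longrightarrow> (z (f1 (f2 j)), z (f1 (f2 i))) \<in> r) \<or>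
     (\<forall>i j. i < j \<longrightarrow> (z (f1 (f2 j)), z (f1 (f2 i))) \<notin> r)"
    by (rule monochromatic_subsequence[of "\<lambda>i j. (z (f1 j), z (f1 i)) \<in> r"])
  \<comment> \<open>The predicate ignores its second index, so Ramsey's theorem acts as the
    pigeonhole principle here.\<close>
  obtain f3 :: "nat \<Rightarrow> nat" where f3: "strict_mono f3"
    "(\<forall>i j. i < j \<longrightarrow> (x, z (f1 (f2 (f3 i)))) \<in> r) \<or> (\<forall>i j. i < j \<longrightarrow> (x, z (f1 (f2 (f3 i)))) \<notin> r)"
    by (rule monochromatic_subsequence[of "\<lambda>i j. (x, z (f1 (f2 i))) \<in> r"])
  have lim3: "limitin X (z \<circ> f1 \<circ> f2 \<circ> f3) x sequentially"
    by (rule limitin_subsequence[OF f3(1) limitin_subsequence[OF f2(1) lim1]])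
  have "\<forall>\<^sub>F n in sequentially. (y, (z \<circ> f1 \<circ> f2 \<circ> f3) n) \<notin> r"
    by (rule eventually_not_above[OF lim3 carrier(2) y_not_le_x])
  then obtain N where N: "\<And>n. n \<ge> N \<Longrightarrow> (y, z (f1 (f2 (f3 n)))) \<notin> r"
    by (auto simp: eventually_sequentially)
  \<comment> \<open>The shift by \<open>N\<close> drops the initial terms that may lie above
    \<open>y\<close>.\<close>
  define w where "w n = z (f1 (f2 (f3 (n + N))))" for n
  have mono: "strict_mono (\<lambda>n. n + N)" by (simp add: strict_mono_def)
  have w_lim: "limitin X w x sequentially"
    using limitin_subsequence[OF mono lim3] by (simp add: w_def[abs_def] o_def)
  have w_carrier: "w n \<in> topspace X" "w n \<notin> downclosure r U" for n using z by (auto simp: w_def)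
  have w_not_le: "(w n, p) \<notin> r" if "p \<in> downclosure r U" for n p
    using z_not_le[OF that] by (simp add: w_def)
  have y_not_le_w: "(y, w n) \<notin> r" for n using N by (simp add: w_def)
  have w_incr: "(w i, w j) \<notin> r" if "i < j" for i j
    using f1_incr f2(1) f3(1) that by (simp add: w_def strict_mono_less)
  have w_decr: "(\<forall>i j. i < j \<longrightarrow> (w j, w i) \<in> r) \<or> (\<forall>i j. i < j \<longrightarrow> (w j, w i) \<notin> r)"
    using f2(2) f3(1) by (auto simp: w_def strict_mono_less)
  have x_le_w: "(\<forall>i. (x, w i) \<in> r) \<or> (\<forall>i. (x, w i) \<notin> r)"
    using f3(2) lessI unfolding w_def by blast

  define e where "e p = (case p of None \<Rightarrow> x | Some Iso_y \<Rightarrow> y | Some (Iso_z n) \<Rightarrow> w n)" for p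
  have e_simps [simp]: "e x_pt = x" "e y_pt = y" "e (z_pt n) = w n" for n by (simp_all add: e_def)
  have cases: "p = x_pt \<or> p = y_pt \<or> (\<exists>n. p = z_pt n)" for p :: Z_pts
    by (metis isolated_pt.exhaust option.exhaust)
  \<comment> \<open>Equal terms would be comparable by reflexivity, against
    \<open>w_incr\<close>.\<close>
  have w_inj: "w i = w j \<longleftrightarrow> i = j" for i j
    using w_incr r_refl[OF w_carrier(1)] by (metis linorder_neqE_nat)
  have distinct: "x \<noteq> y" "w n \<noteq> x" "w n \<noteq> y" for n
    using U w_carrier(2)[of n] x_down y_down by blast+
  have "inj e"
  proof (rule injI)
    fix p q assume "e p = e q"
    then show "p = q"
      using cases[of p] cases[of q] distinct distinct[symmetric] w_inj by auto
  qed
  moreover have "e p \<in> topspace X" for p using cases[of p] carrier w_carrier by auto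
  ultimately have emb: "embedding_map Z_space X e"
    using assms(1) w_lim by (intro embedding_map_Z_space) auto
  have pre: "{p \<in> topspace Z_space. e p \<in> downclosure r U} = {x_pt, y_pt}"
  proof -
    have "e p \<in> downclosure r U \<longleftrightarrow> p = x_pt \<or> p = y_pt" for p
      using cases[of p] x_down y_down w_carrier(2) by auto
    then show ?thesis by (auto simp: topspace_Z_space)
  qed
  have le_x: "(e p, e x_pt) \<in> r \<longleftrightarrow> p = x_pt" for p
    using cases[of p] y_not_le_x w_not_le[OF x_down] r_refl carrier by auto
  have le_y: "(e p, e y_pt) \<in> r \<longleftrightarrow> p = x_pt \<or> p = y_pt" for p
    using cases[of p] xy w_not_le[OF y_down] r_refl carrier by auto
  \<comment> \<open>The hypotheses on \<open>s\<close> first list what the three orders share. The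
    last two leave open what distinguishes them: whether \<open>x\<close> lies below the sequence,
    and the order within it.\<close>
  have embI: "top_order_embedding Z_space s X r e"
    if "\<And>p. (p, x_pt) \<in> s \<longleftrightarrow> p = x_pt" "\<And>p. (p, y_pt) \<in> s \<longleftrightarrow> p = x_pt \<or> p = y_pt"
      "\<And>n. (y_pt, z_pt n) \<notin> s" "\<And>n. (x_pt, z_pt n) \<in> s \<longleftrightarrow> (x, w n) \<in> r"
      "\<And>m n. (z_pt m, z_pt n) \<in> s \<longleftrightarrow> (w m, w n) \<in> r" for s
  proof -
    have "(e p, e q) \<in> r \<longleftrightarrow> (p, q) \<in> s" for p q
      using cases[of q]
    proof (elim disjE exE)
      fix n assume q: "q = z_pt n"
      show ?thesis using cases[of p] that y_not_le_w by (auto simp: q)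
    qed (use le_x le_y that in \<open>simp_all only:\<close>)
    then show ?thesis using emb by (simp add: top_order_embedding_def)
  qed
  have w_le_iff: "(w m, w n) \<in> r \<longleftrightarrow> m = n \<or> n < m" if "\<forall>i j. i < j \<longrightarrow> (w j, w i) \<in> r" for m n
    using that w_incr r_refl[OF w_carrier(1)] by (metis linorder_neqE_nat)
  have w_antichain: "(w m, w n) \<in> r \<longleftrightarrow> m = n" if "\<forall>i j. i < j \<longrightarrow> (w j, w i) \<notin> r" for m n
    using that w_incr r_refl[OF w_carrier(1)] by (metis linorder_neqE_nat)
  consider (decr) "\<forall>i j. i < j \<longrightarrow> (w j, w i) \<in> r"
    | (above) "\<forall>i j. i < j \<longrightarrow> (w j, w i) \<notin> r" "\<forall>i. (x, w i) \<in> r"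
    | (incomparable) "\<forall>i j. i < j \<longrightarrow> (w j, w i) \<notin> r" "\<forall>i. (x, w i) \<notin> r"
    using w_decr x_le_w by blast
  then show ?thesis
  proof cases
    case decr
    \<comment> \<open>All later terms lie below \<open>w n\<close>, and this passes to their limit
      \<open>x\<close>.\<close>
    have "(x, w n) \<in> r" for n
    proof (rule limit_le[OF w_lim w_carrier(1)])
      show "\<forall>\<^sub>F k in sequentially. (w k, w n) \<in> r"
        using eventually_gt_at_top[of n] by (rule eventually_mono) (use decr in blast)
    qed simp
    then have "top_order_embedding Z_space Z1_order X r e"
      by (intro embI) (auto simp: Z1_order_def w_le_iff[OF decr])
    then show ?thesis using pre by auto
  next
    case above
    then have "top_order_embedding Z_space Z2_order X r e"
      by (intro embI) (auto simp: Z2_order_def w_antichain)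
    then show ?thesis using pre by auto
  next
    case incomparable
    then have "top_order_embedding Z_space Z3_order X r e"
      by (intro embI) (auto simp: Z3_order_def w_antichain)
    then show ?thesis using pre by auto
  qed
qed

lemma open_downclosure_iff_no_forbidden_configuration:
  assumes "metrizable_space X"
  shows "\<not> (\<forall>B. openin X B \<longrightarrow> openin X (downclosure r B)) \<longleftrightarrow>
    (\<exists>s \<in> {Z1_order, Z2_order, Z3_order}. \<exists>e U.
       top_order_embedding Z_space s X r e \<and> openin X U \<and> e y_pt \<in> U \<and>
       {p \<in> topspace Z_space. e p \<in> downclosure r U} = {x_pt, y_pt})" (is "_ \<longleftrightarrow> ?config")
proof
  assume ?config
  then show "\<not> (\<forall>B. openin X B \<longrightarrow> openin X (downclosure r B))"
    using forbidden_configuration_imp_not_open by blast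
next
  assume "\<not> (\<forall>B. openin X B \<longrightarrow> openin X (downclosure r B))"
  then obtain B where B: "openin X B" "\<not> openin X (downclosure r B)" by blast
  then have "\<not> closedin X (topspace X - downclosure r B)"
    by (simp add: openin_closedin downclosure_subset)
  moreover obtain M d where M: "Metric_space M d" "X = Metric_space.mtopology M d"
    using assms by (auto simp: metrizable_space_def)
  \<comment> \<open>Metrizability enters here: a set that is not closed is left by the limit of some
    sequence in it.\<close>
  ultimately obtain z x where z: "range z \<subseteq> topspace X - downclosure r B"
    and lim: "limitin X z x sequentially" and "x \<notin> topspace X - downclosure r B"
    using Metric_space.metric_closedin_iff_sequentially_closed[OF M(1)]
      Metric_space.topspace_mtopology[OF M(1)] by (metis Diff_subset)
  then have x: "x \<in> topspace X" "x \<in> downclosure r B" by (auto simp: limitin_def)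
  then obtain y where y: "y \<in> B" "(x, y) \<in> r" by (auto simp: downclosure_def)
  \<comment> \<open>If the limit were in the open set \<open>B\<close>, some \<open>z n\<close>
    would be in \<open>B\<close>, hence in \<down>B.\<close>
  have "x \<notin> B"
  proof
    assume "x \<in> B"
    then have "\<forall>\<^sub>F n in sequentially. z n \<in> B" using lim B(1) by (simp add: limitin_def)
    then obtain n where "z n \<in> B" by (auto simp: eventually_sequentially)
    then show False using z subset_downclosure[OF openin_subset[OF B(1)]] by blast
  qed
  then have "\<exists>s\<in>{Z1_order, Z2_order, Z3_order}. \<exists>e. top_order_embedding Z_space s X r e \<and>
    e y_pt = y \<and> {p \<in> topspace Z_space. e p \<in> downclosure r B} = {x_pt, y_pt}"
    using metrizable_imp_Hausdorff_space[OF assms] B(1) y lim z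
    by (intro forbidden_configuration_of_sequence) auto
  then show ?config using B(1) y(1) by blast
qed

end

theorem corollary3p7:
  fixes X :: "'a topology" and r :: "('a \<times> 'a) set"
  assumes "Priestley_space X r" and "metrizable_space X"
  shows "\<not> dual_to_bi_Heyting_algebra X r \<longleftrightarrow>
    (\<exists>s \<in> {Z1_order, Z2_order, Z3_order}. \<exists>e U.
       top_order_embedding Z_space s X r e \<and> openin X U \<and> e y_pt \<in> U \<and>
       {p \<in> topspace Z_space. e p \<in> downclosure r U} = {x_pt, y_pt}) \<or>
    (\<exists>s \<in> {Z1_order, Z2_order, Z3_order}. \<exists>e U.
       top_order_embedding Z_space (s\<inverse>) X r e \<and> openin X U \<and> e y_pt \<in> U \<and>
       {p \<in> topspace Z_space. e p \<in> upclosure r U} = {x_pt, y_pt})"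
proof -
  interpret priestley X r by unfold_locales (rule assms(1))
  \<comment> \<open>Embedding a reversed \<open>Z\<close> space into \<open>X\<close> amounts to
    embedding the original one into \<open>X\<close> with reversed order. So (b) is (a) for the
    reversed order.\<close>
  have "top_order_embedding Z_space s X (r\<inverse>) e \<longleftrightarrow> top_order_embedding Z_space (s\<inverse>) X r e" for s e
    using top_order_embedding_converse[of Z_space "s\<inverse>" X r e] by simp
  then show ?thesis
    using open_downclosure_iff_no_forbidden_configuration[OF assms(2)]
      priestley.open_downclosure_iff_no_forbidden_configuration[OF priestley_converse assms(2)]
    unfolding dual_to_bi_Heyting_algebra_iff downclosure_converse by simp
qed

end
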